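(* Let $1\le m<n$ be integers and let $X_1,\dots,X_n,Y,Z$ be real-valued random variables on a common probability space, all having finite moments of every order, such that the random vectors $(X_1,\dots,X_m,Y)$ and $(X_{m+1},\dots,X_n,Z)$ are independent and each $X_i$ is nondegenerate. Suppose that the distribution of the statistic $\sum_{i=1}^n a_iX_i+Y+Z$, where $a_1,\dots,a_n\in\mathbb{R}$, depends only on $\sum_{i=1}^n a_i^2$. Then the random variables $X_1,\dots,X_n$ are independent and have the same normal distribution with zero mean, and $\operatorname{cov}(X_i,Y)=\operatorname{cov}(X_i,Z)=0$ for all $i\in\{1,\dots,n\}$.
   Context: A random variable is nondegenerate if it is not almost surely constant. "The distribution depends only on $\sum_{i=1}^n a_i^2$" means: whenever $(a_i),(a_i')\in\mathbb{R}^n$ satisfy $\sum_i a_i^2=\sum_i a_i'^2$, the random variables $\sum_i a_iX_i+Y+Z$ and $\sum_i a_i'X_i+Y+Z$ have the same distribution. Independence of the two vectors does not assume anything about the dependence among the components of each vector; independence of $X_1,\dots,X_n$ in the conclusion is joint (mutual) independence. *)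

theory Defs
  imports "HOL-Probability.Probability"
begin

definition covariance :: "'a measure \<Rightarrow> ('a \<Rightarrow> real) \<Rightarrow> ('a \<Rightarrow> real) \<Rightarrow> real" where
  "covariance M U V =
     (\<integral>\<omega>. (U \<omega> - (\<integral>\<omega>. U \<omega> \<partial>M)) * (V \<omega> - (\<integral>\<omega>. V \<omega> \<partial>M)) \<partial>M)"

definition nondegenerate :: "'a measure \<Rightarrow> ('a \<Rightarrow> real) \<Rightarrow> bool" where
  "nondegenerate M U \<longleftrightarrow> \<not> (\<exists>c. AE \<omega> in M. U \<omega> = c)"

definition all_moments_finite :: "'a measure \<Rightarrow> ('a \<Rightarrow> real) \<Rightarrow> bool" where
  "all_moments_finite M U \<longleftrightarrow> (\<forall>k::nat. integrable M (\<lambda>\<omega>. \<bar>U \<omega>\<bar> ^ k))"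

end

theory Submission
  imports Defs
begin

text \<open>
  Comparing characteristic functions at \<open>t\<close> for coefficients \<open>a / t\<close> and letting \<open>t \<rightarrow> 0\<close> removes
  \<open>Y + Z\<close>: the joint characteristic function of \<open>X\<^sub>1, \<dots>, X\<^sub>n\<close> is radial, \<open>\<phi>(a) = \<psi>(|a|)\<close>. Since \<open>X\<^sub>1\<close> and
  \<open>X\<^sub>n\<close> are independent, \<open>\<psi>(\<surd>(s\<^sup>2 + t\<^sup>2)) = \<psi>(s) \<psi>(t)\<close>. Hence \<open>\<phi>\<close> is a product, which is joint independence, and
  \<open>\<psi>(t) = \<psi>(t / \<surd>k)\<^sup>k\<close> for all \<open>k\<close>, which forces \<open>\<psi>\<close> to be Gaussian as in the central limit theorem.
  The first two moments of \<open>\<plusminus>X\<^sub>i + Y + Z\<close> agree, so \<open>X\<^sub>i\<close> is centred and uncorrelated with \<open>Y + Z\<close>; as it is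
  independent of one of \<open>Y\<close>, \<open>Z\<close>, it is uncorrelated with both.
\<close>

section \<open>Independence from factorising characteristic functions\<close>

text \<open>
  A nonnegative bounded weight with the hypothesised factorisation is a change of measure that preserves the
  characteristic function of \<open>X\<close>, so Levy's uniqueness theorem applies; adding a constant makes \<open>W\<close> positive.
\<close>

lemma (in prob_space) integral_mult_indicator_of_char_real:
  fixes W X :: "'a \<Rightarrow> real"
  assumes [measurable]: "W \<in> borel_measurable M" "X \<in> borel_measurable M" "A \<in> sets borel"
    and bound: "\<And>\<omega>. \<bar>W \<omega>\<bar> \<le> C"
    and factor: "\<And>u. (CLINT \<omega>|M. W \<omega> * iexp (u * X \<omega>)) =
      complex_of_real (LINT \<omega>|M. W \<omega>) * char (distr M borel X) u"
  shows "(LINT \<omega>|M. W \<omega> * indicator A (X \<omega>)) = (LINT \<omega>|M. W \<omega>) * (LINT \<omega>|M. indicator A (X \<omega>))"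
proof -
  \<comment> \<open>The shift is \<open>C + 1\<close> rather than \<open>C\<close>, so that
    \<open>V\<close> is at least 1 and its integral \<open>p\<close> is a safe divisor.\<close>
  define V where "V \<omega> = W \<omega> + (C + 1)" for \<omega>
  have V_meas [measurable]: "V \<in> borel_measurable M"
    unfolding V_def by measurable
  have V_ge: "V \<omega> \<ge> 1" for \<omega>
    using bound[of \<omega>] by (simp add: V_def abs_le_iff)
  have int_W: "integrable M W"
    using bound by (intro integrable_const_bound[of _ C]) auto
  have int_V: "integrable M V"
    unfolding V_def using int_W by simp
  define p where "p = (LINT \<omega>|M. V \<omega>)"
  have p_eq: "p = (LINT \<omega>|M. W \<omega>) + (C + 1)"
    unfolding p_def V_def using int_W by (simp add: prob_space)
  have "(LINT \<omega>|M. 1) \<le> p"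
    unfolding p_def using V_ge int_V by (intro integral_mono) auto
  then have p: "p \<ge> 1"
    by (simp add: prob_space)
  define N where "N = density M (\<lambda>\<omega>. ennreal (V \<omega> / p))"
  have nonneg: "0 \<le> V \<omega> / p" for \<omega>
    using V_ge[of \<omega>] p by auto
  have "emeasure N (space N) = (\<integral>\<^sup>+ \<omega>. ennreal (V \<omega> / p) \<partial>M)"
    by (simp add: N_def emeasure_density)
  also have "\<dots> = ennreal (LINT \<omega>|M. V \<omega> / p)"
    using int_V nonneg by (intro nn_integral_eq_integral) auto
  also have "(LINT \<omega>|M. V \<omega> / p) = 1"
    using p by (simp add: p_def)
  finally interpret N: prob_space N
    by (intro prob_spaceI) simp
  have X_N [measurable]: "X \<in> borel_measurable N"
    by (simp add: N_def)
  have int_e: "integrable M (\<lambda>\<omega>. iexp (u * X \<omega>))" for u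
    by (intro integrable_const_bound[of _ 1]) auto
  have int_We: "integrable M (\<lambda>\<omega>. W \<omega> * iexp (u * X \<omega>))" for u
    using bound by (intro integrable_const_bound[of _ C]) (auto simp: norm_mult)
  \<comment> \<open>Both summands of \<open>V\<close> multiply the characteristic function of
    \<open>X\<close> by their own means; these add up to \<open>p\<close>, which the normalisation
    cancels.\<close>
  have "char (distr N borel X) u = char (distr M borel X) u" for u
  proof -
    have "char (distr N borel X) u = (CLINT \<omega>|M. (V \<omega> / p) *\<^sub>R iexp (u * X \<omega>))"
      unfolding char_def N_def using nonneg by (simp add: integral_distr integral_density)
    also have "\<dots> = (CLINT \<omega>|M. (W \<omega> * iexp (u * X \<omega>) + (C + 1) * iexp (u * X \<omega>)) / p)"
      by (intro Bochner_Integration.integral_cong) (simp_all add: V_def scaleR_conv_of_real field_simps)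
    also have "\<dots> = ((CLINT \<omega>|M. W \<omega> * iexp (u * X \<omega>)) + (C + 1) * (CLINT \<omega>|M. iexp (u * X \<omega>))) / p"
      by (subst integral_divide_zero, subst Bochner_Integration.integral_add[OF int_We])
         (use int_e[of u] in auto)
    also have "(CLINT \<omega>|M. iexp (u * X \<omega>)) = char (distr M borel X) u"
      by (simp add: char_def integral_distr)
    also have "((CLINT \<omega>|M. W \<omega> * iexp (u * X \<omega>)) + (C + 1) * char (distr M borel X) u) / p
       = complex_of_real p * char (distr M borel X) u / p"
      by (simp only: factor) (simp add: p_eq algebra_simps)
    also have "\<dots> = char (distr M borel X) u"
      using p by simp
    finally show ?thesis .
  qed
  then have "distr N borel X = distr M borel X"
    by (intro Levy_uniqueness N.real_distribution_distr real_distribution_distr) auto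
  then have "(LINT x|distr N borel X. indicator A x) = (LINT x|distr M borel X. indicator A x :: real)"
    by simp
  moreover have "(LINT x|distr N borel X. indicator A x :: real) = (LINT \<omega>|N. indicator A (X \<omega>))"
    "(LINT x|distr M borel X. indicator A x :: real) = (LINT \<omega>|M. indicator A (X \<omega>))"
    by (rule integral_distr; measurable)+
  moreover have "(LINT \<omega>|N. indicator A (X \<omega>)) = (LINT \<omega>|M. (V \<omega> / p) *\<^sub>R (indicator A (X \<omega>) :: real))"
    unfolding N_def using nonneg by (intro integral_density) auto
  ultimately have "(LINT \<omega>|M. (V \<omega> / p) * indicator A (X \<omega>)) = (LINT \<omega>|M. indicator A (X \<omega>))"
    by simp
  moreover have "(LINT \<omega>|M. (V \<omega> / p) * indicator A (X \<omega>)) =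
      (LINT \<omega>|M. W \<omega> * indicator A (X \<omega>) + (C + 1) * indicator A (X \<omega>)) / p"
    by (subst integral_divide_zero[symmetric], intro Bochner_Integration.integral_cong)
       (simp_all add: V_def field_simps)
  moreover have "(LINT \<omega>|M. W \<omega> * indicator A (X \<omega>) + (C + 1) * indicator A (X \<omega>)) =
      (LINT \<omega>|M. W \<omega> * indicator A (X \<omega>)) + (C + 1) * (LINT \<omega>|M. indicator A (X \<omega>))"
  proof -
    have "integrable M (\<lambda>\<omega>. W \<omega> * indicator A (X \<omega>))"
      using bound order_trans[OF abs_ge_zero bound]
      by (intro integrable_const_bound[of _ C]) (auto simp: indicator_def)
    moreover have "integrable M (\<lambda>\<omega>. (C + 1) * indicator A (X \<omega>))"
      by (intro integrable_mult_right integrable_const_bound[of _ 1]) (auto simp: indicator_def)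
    ultimately show ?thesis
      by (simp del: integral_indicator)
  qed
  \<comment> \<open>The shift contributes the same multiple of the indicator's mean to both sides,
    so the identity for \<open>V\<close> descends to \<open>W\<close>.\<close>
  ultimately have "(LINT \<omega>|M. W \<omega> * indicator A (X \<omega>)) + (C + 1) * (LINT \<omega>|M. indicator A (X \<omega>)) =
      p * (LINT \<omega>|M. indicator A (X \<omega>))"
    using p by (simp add: field_simps)
  then show ?thesis
    by (simp add: p_eq algebra_simps)
qed

text \<open>The weights met below are products of exponentials and indicators, hence complex. The
  factorisation passes to the conjugate weight, and so by linearity to the real and imaginary parts,
  where the real case applies.\<close>

lemma (in prob_space) integral_mult_indicator_of_char:
  fixes W :: "'a \<Rightarrow> complex" and X :: "'a \<Rightarrow> real"
  assumes [measurable]: "W \<in> borel_measurable M" "X \<in> borel_measurable M" "A \<in> sets borel"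
    and bound: "\<And>\<omega>. norm (W \<omega>) \<le> C"
    and factor: "\<And>u. (CLINT \<omega>|M. W \<omega> * iexp (u * X \<omega>)) = (CLINT \<omega>|M. W \<omega>) * char (distr M borel X) u"
  shows "(CLINT \<omega>|M. W \<omega> * indicator A (X \<omega>)) = (CLINT \<omega>|M. W \<omega>) * of_real (LINT \<omega>|M. indicator A (X \<omega>))"
proof -
  let ?\<phi> = "char (distr M borel X)"
  have int_W: "integrable M W"
    using bound by (intro integrable_const_bound[of _ C]) auto
  have int_We: "integrable M (\<lambda>\<omega>. W \<omega> * iexp (u * X \<omega>))" for u
    using bound by (intro integrable_const_bound[of _ C]) (auto simp: norm_mult)
  have [measurable]: "(\<lambda>\<omega>. cnj (W \<omega>)) \<in> borel_measurable M"
    by (rule borel_measurable_continuous_on[OF _ assms(1)]) (intro continuous_intros)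
  have int_cWe: "integrable M (\<lambda>\<omega>. cnj (W \<omega>) * iexp (u * X \<omega>))" for u
    using bound by (intro integrable_const_bound[of _ C]) (auto simp: norm_mult)
  have cnj_iexp: "cnj (iexp x) = iexp (- x)" for x
    by (simp add: exp_cnj)
  \<comment> \<open>Conjugating reverses the frequency, so the hypothesis is taken at
    \<open>-u\<close> and conjugated.\<close>
  have factor_cnj: "(CLINT \<omega>|M. cnj (W \<omega>) * iexp (u * X \<omega>)) = cnj (CLINT \<omega>|M. W \<omega>) * ?\<phi> u" for u
  proof -
    have "(CLINT \<omega>|M. cnj (W \<omega>) * iexp (u * X \<omega>)) = (CLINT \<omega>|M. cnj (W \<omega> * iexp (- u * X \<omega>)))"
      by (intro Bochner_Integration.integral_cong refl)
         (simp only: complex_cnj_mult cnj_iexp mult_minus_left minus_minus)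
    also have "\<dots> = cnj (CLINT \<omega>|M. W \<omega>) * cnj (?\<phi> (- u))"
      unfolding Bochner_Integration.integral_cnj using factor[of "- u"] by simp
    also have "cnj (?\<phi> (- u)) = ?\<phi> u"
      unfolding char_def Bochner_Integration.integral_cnj[symmetric]
      by (intro Bochner_Integration.integral_cong refl)
         (simp only: complex_cnj_mult cnj_iexp mult_minus_left minus_minus)
    finally show ?thesis .
  qed
  have ReW: "complex_of_real (Re z) = (z + cnj z) / 2" for z
    by (simp add: complex_eq_iff)
  have ImW: "complex_of_real (Im z) = (z - cnj z) / (2 * \<i>)" for z
    by (simp add: complex_eq_iff Re_divide Im_divide)
  have Re_part: "(LINT \<omega>|M. Re (W \<omega>) * indicator A (X \<omega>)) = (LINT \<omega>|M. Re (W \<omega>)) * (LINT \<omega>|M. indicator A (X \<omega>))"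
  proof (rule integral_mult_indicator_of_char_real[where C = C])
    fix u
    have "(CLINT \<omega>|M. Re (W \<omega>) * iexp (u * X \<omega>)) =
        (CLINT \<omega>|M. (W \<omega> * iexp (u * X \<omega>) + cnj (W \<omega>) * iexp (u * X \<omega>)) / 2)"
      by (intro Bochner_Integration.integral_cong) (auto simp: ReW field_simps)
    also have "\<dots> = ((CLINT \<omega>|M. W \<omega>) * ?\<phi> u + cnj (CLINT \<omega>|M. W \<omega>) * ?\<phi> u) / 2"
      by (subst integral_divide_zero, subst Bochner_Integration.integral_add[OF int_We int_cWe])
         (simp only: factor factor_cnj)
    also have "\<dots> = complex_of_real (Re (CLINT \<omega>|M. W \<omega>)) * ?\<phi> u"
      by (simp add: ReW field_simps)
    finally show "(CLINT \<omega>|M. Re (W \<omega>) * iexp (u * X \<omega>)) = complex_of_real (LINT \<omega>|M. Re (W \<omega>)) * ?\<phi> u"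
      using int_W by simp
  qed (use bound abs_Re_le_cmod order_trans in \<open>auto, blast\<close>)
  have Im_part: "(LINT \<omega>|M. Im (W \<omega>) * indicator A (X \<omega>)) = (LINT \<omega>|M. Im (W \<omega>)) * (LINT \<omega>|M. indicator A (X \<omega>))"
  proof (rule integral_mult_indicator_of_char_real[where C = C])
    fix u
    have "(CLINT \<omega>|M. Im (W \<omega>) * iexp (u * X \<omega>)) =
        (CLINT \<omega>|M. (W \<omega> * iexp (u * X \<omega>) - cnj (W \<omega>) * iexp (u * X \<omega>)) / (2 * \<i>))"
      by (intro Bochner_Integration.integral_cong) (auto simp: ImW field_simps)
    also have "\<dots> = ((CLINT \<omega>|M. W \<omega>) * ?\<phi> u - cnj (CLINT \<omega>|M. W \<omega>) * ?\<phi> u) / (2 * \<i>)"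
      by (subst integral_divide_zero, subst Bochner_Integration.integral_diff[OF int_We int_cWe])
         (simp only: factor factor_cnj)
    also have "\<dots> = complex_of_real (Im (CLINT \<omega>|M. W \<omega>)) * ?\<phi> u"
      by (simp add: ImW field_simps)
    finally show "(CLINT \<omega>|M. Im (W \<omega>) * iexp (u * X \<omega>)) = complex_of_real (LINT \<omega>|M. Im (W \<omega>)) * ?\<phi> u"
      using int_W by simp
  qed (use bound abs_Im_le_cmod order_trans in \<open>auto, blast\<close>)
  have "integrable M (\<lambda>\<omega>. W \<omega> * indicator A (X \<omega>))"
    using bound order_trans[OF norm_ge_zero bound]
    by (intro integrable_const_bound[of _ C]) (auto simp: indicator_def)
  moreover have "Re (W \<omega> * indicator A (X \<omega>)) = Re (W \<omega>) * indicator A (X \<omega>)"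
    "Im (W \<omega> * indicator A (X \<omega>)) = Im (W \<omega>) * indicator A (X \<omega>)" for \<omega>
    by (auto simp: indicator_def)
  ultimately show ?thesis
    using Re_part Im_part int_W
    by (simp add: complex_eq_iff integral_Re[symmetric] integral_Im[symmetric]
        del: integral_indicator integral_Re integral_Im)
qed

text \<open>One-dimensional uniqueness suffices: when a single coordinate is treated, all the others
  are absorbed into a bounded complex weight. After the last coordinate the factorisation is the
  product rule for probabilities of rectangles.\<close>

lemma (in prob_space) indep_vars_of_char:
  fixes X :: "'i \<Rightarrow> 'a \<Rightarrow> real"
  assumes "finite I"
    and meas: "\<And>i. i \<in> I \<Longrightarrow> X i \<in> borel_measurable M"
    and factor: "\<And>u. (CLINT \<omega>|M. iexp (\<Sum>i\<in>I. u i * X i \<omega>)) = (\<Prod>i\<in>I. char (distr M borel (X i)) (u i))"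
  shows "indep_vars (\<lambda>_. borel) X I"
\<comment> \<open>The product criterion \<open>indep_vars_finite\<close> and the measurability of
  the finite intersection need a nonempty index set.\<close>
proof (cases "I = {}")
  case True
  then show ?thesis
    by (simp add: indep_vars_def2 indep_sets_def)
next
  case False
  \<comment> \<open>A hybrid integrand: coordinates in \<open>J\<close> already carry indicators,
    the others still exponentials. The numbers \<open>q\<close> are the means of the individual
    factors.\<close>
  define g :: "'i set \<Rightarrow> ('i \<Rightarrow> real set) \<Rightarrow> ('i \<Rightarrow> real) \<Rightarrow> 'i \<Rightarrow> 'a \<Rightarrow> complex" where
    "g J A u i \<omega> = (if i \<in> J then indicator (A i) (X i \<omega>) else iexp (u i * X i \<omega>))" for J A u i \<omega>
  define q :: "'i set \<Rightarrow> ('i \<Rightarrow> real set) \<Rightarrow> ('i \<Rightarrow> real) \<Rightarrow> 'i \<Rightarrow> complex" where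
    "q J A u i = (if i \<in> J then of_real (LINT \<omega>|M. indicator (A i) (X i \<omega>)) else char (distr M borel (X i)) (u i))" for J A u i
  have norm_g: "norm (g J A u i \<omega>) \<le> 1" for J A u i \<omega>
    by (simp add: g_def indicator_def)
  have meas_g: "g J A u i \<in> borel_measurable M" if "i \<in> I" "A i \<in> sets borel" for J A u i
  proof -
    have [measurable]: "X i \<in> borel_measurable M" "A i \<in> sets borel"
      using that meas by auto
    show ?thesis
      by (cases "i \<in> J") (auto simp: g_def[abs_def])
  qed
  \<comment> \<open>Exponentials are exchanged for indicators one coordinate at a time.\<close>
  have exchange: "(CLINT \<omega>|M. (\<Prod>i\<in>I. g J A u i \<omega>)) = (\<Prod>i\<in>I. q J A u i)"
    if "finite J" "J \<subseteq> I" and A: "\<And>i. i \<in> I \<Longrightarrow> A i \<in> sets borel" for J A u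
    using that(1,2)
  proof (induction J arbitrary: u rule: finite_induct)
    case empty
    have "(CLINT \<omega>|M. (\<Prod>i\<in>I. g {} A u i \<omega>)) = (CLINT \<omega>|M. iexp (\<Sum>i\<in>I. u i * X i \<omega>))"
      by (simp add: g_def exp_sum[OF \<open>finite I\<close>] sum_distrib_left)
    then show ?case
      by (simp only: factor q_def empty_iff if_False)
  next
    case (insert j J)
    then have j: "j \<in> I" and J: "J \<subseteq> I"
      by auto
    have [measurable]: "X j \<in> borel_measurable M"
      using meas j by auto
    define W where "W \<omega> = (\<Prod>i\<in>I - {j}. g J A u i \<omega>)" for \<omega>
    define Q where "Q = (\<Prod>i\<in>I - {j}. q J A u i)"
    have norm_W: "norm (W \<omega>) \<le> 1" for \<omega>
      unfolding W_def by (subst prod_norm[symmetric]) (intro prod_le_1, auto simp: norm_g)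
    have meas_W: "W \<in> borel_measurable M"
      unfolding W_def[abs_def] using A meas_g by (intro borel_measurable_prod) auto
    \<comment> \<open>As \<open>j\<close> is not in \<open>J\<close>, its factor is still an
      exponential. The induction hypothesis holds for every \<open>u\<close>, so the frequency at
      \<open>j\<close> can be replaced by any \<open>v\<close> without changing
      \<open>W\<close>.\<close>
    have WX: "(CLINT \<omega>|M. W \<omega> * iexp (v * X j \<omega>)) = Q * char (distr M borel (X j)) v" for v
    proof -
      have "(CLINT \<omega>|M. W \<omega> * iexp (v * X j \<omega>)) = (CLINT \<omega>|M. (\<Prod>i\<in>I. g J A (u(j := v)) i \<omega>))"
        using insert.hyps \<open>finite I\<close> j
        by (intro Bochner_Integration.integral_cong refl)
           (auto simp: W_def prod.remove[of I j] g_def split: if_splits intro!: prod.cong)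
      also have "\<dots> = (\<Prod>i\<in>I. q J A (u(j := v)) i)"
        by (rule insert.IH[OF J])
      also have "\<dots> = Q * char (distr M borel (X j)) v"
        using insert.hyps \<open>finite I\<close> j
        by (auto simp: Q_def prod.remove[of I j] q_def split: if_splits intro!: prod.cong)
      finally show ?thesis .
    qed
    interpret Xj: real_distribution "distr M borel (X j)"
      by simp
    have W: "(CLINT \<omega>|M. W \<omega>) = Q"
      using WX[of 0] by (simp add: Xj.char_zero)
    have "(CLINT \<omega>|M. (\<Prod>i\<in>I. g (insert j J) A u i \<omega>)) = (CLINT \<omega>|M. W \<omega> * indicator (A j) (X j \<omega>))"
      using insert.hyps \<open>finite I\<close> j
      by (intro Bochner_Integration.integral_cong refl)
         (auto simp: W_def prod.remove[of I j] g_def split: if_splits intro!: prod.cong)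
    also have "\<dots> = Q * of_real (LINT \<omega>|M. indicator (A j) (X j \<omega>))"
      unfolding W[symmetric] using WX norm_W meas_W A j
      by (intro integral_mult_indicator_of_char[where C = 1]) (auto simp: W)
    also have "\<dots> = (\<Prod>i\<in>I. q (insert j J) A u i)"
      using insert.hyps \<open>finite I\<close> j
      by (auto simp: Q_def prod.remove[of I j] q_def split: if_splits intro!: prod.cong)
    finally show ?case .
  qed
  show ?thesis
  proof (subst indep_vars_finite[where E = "\<lambda>_. sets borel"])
    show "\<forall>A\<in>I \<rightarrow> sets borel. prob (\<Inter>j\<in>I. X j -` A j \<inter> space M) = (\<Prod>j\<in>I. prob (X j -` A j \<inter> space M))"
    proof
      fix A :: "'i \<Rightarrow> real set" assume "A \<in> I \<rightarrow> sets borel"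
      then have A: "A i \<in> sets borel" if "i \<in> I" for i
        using that by auto
      have sets: "X i -` A i \<inter> space M \<in> events" if "i \<in> I" for i
        using A meas that by (intro measurable_sets) auto
      let ?B = "\<Inter>j\<in>I. X j -` A j \<inter> space M"
      have "complex_of_real (prob ?B) = (CLINT \<omega>|M. complex_of_real (indicator ?B \<omega>))"
        using sets False \<open>finite I\<close> by (simp add: sets.finite_INT)
      \<comment> \<open>With \<open>J = I\<close> no exponential is left, so the frequency vector is
        a dummy.\<close>
      also have "\<dots> = (CLINT \<omega>|M. (\<Prod>i\<in>I. g I A (\<lambda>_. 0) i \<omega>))"
      proof (intro Bochner_Integration.integral_cong refl)
        fix \<omega> assume "\<omega> \<in> space M"
        then show "complex_of_real (indicator ?B \<omega>) = (\<Prod>i\<in>I. g I A (\<lambda>_. 0) i \<omega>)"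
          using \<open>finite I\<close> by (auto simp: g_def indicator_def)
      qed
      also have "\<dots> = (\<Prod>i\<in>I. q I A (\<lambda>_. 0) i)"
        using \<open>finite I\<close> A by (intro exchange) auto
      also have "\<dots> = complex_of_real (\<Prod>i\<in>I. prob (X i -` A i \<inter> space M))"
      proof -
        have "(LINT \<omega>|M. indicator (A i) (X i \<omega>)) = prob (X i -` A i \<inter> space M)" if "i \<in> I" for i
        proof -
          have "(LINT \<omega>|M. indicator (A i) (X i \<omega>)) = (LINT \<omega>|M. indicator (X i -` A i \<inter> space M) \<omega> :: real)"
            by (intro Bochner_Integration.integral_cong) (auto simp: indicator_def)
          then show ?thesis
            using sets[OF that] by simp
        qed
        then show ?thesis
          by (simp add: q_def)
      qed
      finally show "prob ?B = (\<Prod>j\<in>I. prob (X j -` A j \<inter> space M))"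
        by (simp only: of_real_eq_iff)
    qed
  qed (use False \<open>finite I\<close> meas in \<open>auto simp: Int_stable_def sets.sigma_sets_eq[of borel, simplified]\<close>)
qed

section \<open>Gaussian characteristic functions and normal laws\<close>

text \<open>Stability writes \<open>char M t\<close> as an \<open>n\<close>-th power near the
  origin. The second-order Taylor polynomial there has \<open>n\<close>-th power tending to the
  Gaussian; the finite third moment makes the error per factor of order \<open>n\<close> to the
  -3/2, so \<open>n\<close> factors still contribute a null sequence.\<close>

lemma (in real_distribution) char_eq_gaussian:
  assumes int3: "integrable M (\<lambda>x. \<bar>x\<bar> ^ 3)"
    and int1: "integrable M (\<lambda>x. x)" and mean: "expectation (\<lambda>x. x) = 0"
    and int2: "integrable M (\<lambda>x. x\<^sup>2)" and second: "expectation (\<lambda>x. x\<^sup>2) = \<sigma>\<^sup>2"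
    and stable: "\<And>n. n > 0 \<Longrightarrow> char M t = char M (t / sqrt (real n)) ^ n"
  shows "char M t = exp (- (\<sigma> * t)\<^sup>2 / 2)"
proof -
  define K where "K = \<bar>t\<bar> ^ 3 / 6 * expectation (\<lambda>x. \<bar>x\<bar> ^ 3)"
  let ?w = "\<lambda>n. 1 + (- (\<sigma> * t)\<^sup>2 / 2) / real n"
  have "(\<lambda>n. complex_of_real (?w n ^ n)) \<longlonglongrightarrow> complex_of_real (exp (- (\<sigma> * t)\<^sup>2 / 2))"
    by (intro tendsto_of_real tendsto_exp_limit_sequentially)
  moreover have "(\<lambda>n. char M t - complex_of_real (?w n ^ n)) \<longlonglongrightarrow> 0"
  proof (rule Lim_null_comparison)
    show "(\<lambda>n. K / sqrt (real n)) \<longlonglongrightarrow> 0"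
      by (intro tendsto_divide_0[OF tendsto_const] filterlim_at_top_imp_at_infinity
          filterlim_compose[OF sqrt_at_top filterlim_real_sequentially])
    show "\<forall>\<^sub>F n in sequentially. norm (char M t - complex_of_real (?w n ^ n)) \<le> K / sqrt (real n)"
    proof (rule eventually_sequentiallyI)
      \<comment> \<open>The bound puts \<open>?w n\<close> in [-1, 1], as comparing powers requires;
        \<open>Suc\<close> ensures that \<open>n\<close> is positive.\<close>
      fix n assume "n \<ge> Suc (nat \<lceil>(\<sigma> * t)\<^sup>2 / 4\<rceil>)"
      then have n0: "n > 0" and "nat \<lceil>(\<sigma> * t)\<^sup>2 / 4\<rceil> \<le> n"
        by linarith+
      then have n: "(\<sigma> * t)\<^sup>2 / 4 \<le> real n"
        using real_nat_ceiling_ge[of "(\<sigma> * t)\<^sup>2 / 4"] by linarith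
      let ?s = "t / sqrt (real n)"
      have w1: "\<bar>?w n\<bar> \<le> 1"
        using n n0 by (auto simp: abs_le_iff field_simps)
      have "norm (char M ?s - complex_of_real (1 - ?s\<^sup>2 * \<sigma>\<^sup>2 / 2)) \<le>
          ?s\<^sup>2 / 6 * expectation (\<lambda>x. min (6 * x\<^sup>2) (\<bar>?s\<bar> * \<bar>x\<bar> ^ 3))"
        using char_approx3[OF int1 mean int2, of "\<sigma>\<^sup>2" ?s] mean second by simp
      \<comment> \<open>Only the cubic branch of the minimum is kept, since it supplies the extra
        factor \<open>1 / sqrt n\<close>.\<close>
      also have "\<dots> \<le> ?s\<^sup>2 / 6 * expectation (\<lambda>x. \<bar>?s\<bar> * \<bar>x\<bar> ^ 3)"
        using int2 int3 by (intro mult_left_mono integral_mono Bochner_Integration.integrable_min) auto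
      also have "\<dots> = K / (real n * sqrt (real n))"
      proof -
        have "\<bar>t\<bar> ^ 3 = t\<^sup>2 * \<bar>t\<bar>"
          by (simp add: power3_eq_cube power2_eq_square)
        then have "?s\<^sup>2 / 6 * (\<bar>?s\<bar> * c) = \<bar>t\<bar> ^ 3 / 6 * c / (real n * sqrt (real n))" for c
          by (simp add: power_divide)
        then show ?thesis
          unfolding integral_mult_right_zero K_def .
      qed
      also have "1 - ?s\<^sup>2 * \<sigma>\<^sup>2 / 2 = ?w n"
        using n0 by (simp add: power_divide power_mult_distrib field_simps)
      finally have approx: "norm (char M ?s - complex_of_real (?w n)) \<le> K / (real n * sqrt (real n))" .
      have "norm (char M t - complex_of_real (?w n ^ n)) = norm (char M ?s ^ n - complex_of_real (?w n) ^ n)"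
        using stable[OF n0] by simp
      \<comment> \<open>In the closed unit disc, \<open>n\<close>-th powers differ by at most
        \<open>n\<close> times the difference of their bases.\<close>
      also have "\<dots> \<le> n * norm (char M ?s - complex_of_real (?w n))"
        using w1 by (intro norm_power_diff cmod_char_le_1) (simp only: norm_of_real)
      also have "\<dots> \<le> n * (K / (real n * sqrt (real n)))"
        by (intro mult_left_mono approx) simp
      also have "\<dots> = K / sqrt (real n)"
        using n0 by simp
      finally show "norm (char M t - complex_of_real (?w n ^ n)) \<le> K / sqrt (real n)" .
    qed
  qed
  ultimately have "(\<lambda>n. char M t) \<longlonglongrightarrow> complex_of_real (exp (- (\<sigma> * t)\<^sup>2 / 2))"
    by (rule Lim_transform)
  then show ?thesis
    by (simp add: LIMSEQ_const_iff)
qed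

lemma (in prob_space) distributed_normal_of_char:
  fixes X :: "'a \<Rightarrow> real"
  assumes [measurable]: "X \<in> borel_measurable M" and "\<sigma> > 0"
    and char: "\<And>t. char (distr M borel X) t = exp (- (\<sigma> * t)\<^sup>2 / 2)"
  shows "distributed M lborel X (normal_density 0 \<sigma>)"
proof -
  let ?U = "\<lambda>\<omega>. X \<omega> / \<sigma>"
  have "char (distr M borel ?U) t = char std_normal_distribution t" for t
  proof -
    have "char (distr M borel ?U) t = char (distr M borel X) (t / \<sigma>)"
      by (simp add: char_def integral_distr)
    also have "\<dots> = char std_normal_distribution t"
      using \<open>\<sigma> > 0\<close> by (simp add: char char_std_normal_distribution)
    finally show ?thesis .
  qed
  then have "distr M borel ?U = std_normal_distribution"
    by (intro Levy_uniqueness real_distribution_distr real_dist_normal_dist) auto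
  \<comment> \<open>\<open>distributed\<close> refers to \<open>lborel\<close>; a push-forward sees
    only the sigma-algebra of its target, so \<open>borel\<close> may be exchanged for it.\<close>
  then have "distr M lborel ?U = std_normal_distribution"
    by (simp cong: distr_cong)
  then have "distributed M lborel ?U std_normal_density"
    by (simp add: distributed_def)
  then show ?thesis
    using \<open>\<sigma> > 0\<close> normal_standard_normal_convert[of \<sigma> X 0] by simp
qed

section \<open>Radial multiplicativity, a limit and moment identities\<close>

text \<open>Each new coordinate is one leg of a right triangle whose other leg is the norm so far.
  This serves both the factorisation over the coefficients and the splitting of one argument into
  \<open>k\<close> equal parts.\<close>

lemma multiplicative_on_norm_prod:
  fixes \<psi> :: "real \<Rightarrow> complex"
  assumes "\<psi> 0 = 1" and mult: "\<And>s t. \<psi> (sqrt (s\<^sup>2 + t\<^sup>2)) = \<psi> s * \<psi> t" and "finite F"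
  shows "\<psi> (sqrt (\<Sum>i\<in>F. (a i)\<^sup>2)) = (\<Prod>i\<in>F. \<psi> (a i))"
  using \<open>finite F\<close>
proof (induction F rule: finite_induct)
  case (insert j F)
  have "sqrt (\<Sum>i\<in>insert j F. (a i)\<^sup>2) = sqrt ((a j)\<^sup>2 + (sqrt (\<Sum>i\<in>F. (a i)\<^sup>2))\<^sup>2)"
    using insert.hyps by (simp add: sum_nonneg)
  then show ?case
    using insert by (simp only: mult) simp
qed (simp add: assms(1))

lemma (in prob_space) tendsto_integral_iexp_add_small:
  fixes U V :: "'a \<Rightarrow> real"
  assumes [measurable]: "U \<in> borel_measurable M" "V \<in> borel_measurable M"
  shows "(\<lambda>k. CLINT \<omega>|M. iexp (U \<omega> + inverse (real (Suc k)) * V \<omega>)) \<longlonglongrightarrow> (CLINT \<omega>|M. iexp (U \<omega>))"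
proof (rule integral_dominated_convergence[where w = "\<lambda>_. 1"])
  have "(\<lambda>k. iexp (U \<omega> + inverse (real (Suc k)) * V \<omega>)) \<longlonglongrightarrow> iexp (U \<omega> + 0 * V \<omega>)" for \<omega>
    by (intro tendsto_intros LIMSEQ_inverse_real_of_nat)
  then show "AE \<omega> in M. (\<lambda>k. iexp (U \<omega> + inverse (real (Suc k)) * V \<omega>)) \<longlonglongrightarrow> iexp (U \<omega>)"
    by simp
qed (auto simp del: of_real_add of_real_mult)

text \<open>Equal first moments give \<open>E U = - E U\<close>; in the equal second moments the
  squares cancel, leaving four times the mean of \<open>U V\<close> equal to zero.\<close>

lemma (in prob_space) moments_of_symmetric_shift:
  fixes U V :: "'a \<Rightarrow> real"
  assumes [measurable]: "U \<in> borel_measurable M" "V \<in> borel_measurable M"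
    and int: "integrable M U" "integrable M V" "integrable M (\<lambda>\<omega>. (U \<omega>)\<^sup>2)" "integrable M (\<lambda>\<omega>. (V \<omega>)\<^sup>2)"
      "integrable M (\<lambda>\<omega>. U \<omega> * V \<omega>)"
    and distr: "distr M borel (\<lambda>\<omega>. U \<omega> + V \<omega>) = distr M borel (\<lambda>\<omega>. - U \<omega> + V \<omega>)"
  shows "expectation U = 0" "expectation (\<lambda>\<omega>. U \<omega> * V \<omega>) = 0"
proof -
  have eq: "expectation (\<lambda>\<omega>. f (U \<omega> + V \<omega>)) = expectation (\<lambda>\<omega>. f (- U \<omega> + V \<omega>))"
    if [measurable]: "f \<in> borel_measurable borel" for f :: "real \<Rightarrow> real"
    using arg_cong[OF distr, of "\<lambda>N. LINT x|N. f x"] by (simp add: integral_distr)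
  show "expectation U = 0"
    using eq[of "\<lambda>x. x"] int by simp
  have "expectation (\<lambda>\<omega>. (U \<omega>)\<^sup>2 + (V \<omega>)\<^sup>2 + 2 * (U \<omega> * V \<omega>)) = expectation (\<lambda>\<omega>. (U \<omega>)\<^sup>2 + (V \<omega>)\<^sup>2 - 2 * (U \<omega> * V \<omega>))"
    using eq[of "\<lambda>x. x\<^sup>2"] by (simp add: power2_eq_square algebra_simps)
  then show "expectation (\<lambda>\<omega>. U \<omega> * V \<omega>) = 0"
    using int by simp
qed

lemma (in prob_space) integrable_mult_of_squares:
  fixes U V :: "'a \<Rightarrow> real"
  assumes [measurable]: "U \<in> borel_measurable M" "V \<in> borel_measurable M"
    and "integrable M (\<lambda>\<omega>. (U \<omega>)\<^sup>2)" "integrable M (\<lambda>\<omega>. (V \<omega>)\<^sup>2)"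
  shows "integrable M (\<lambda>\<omega>. U \<omega> * V \<omega>)"
proof (rule Bochner_Integration.integrable_bound[OF Bochner_Integration.integrable_add[OF assms(3,4)]])
  have "\<bar>x * y\<bar> \<le> x\<^sup>2 + y\<^sup>2" for x y :: real
    using sum_squares_bound[of "\<bar>x\<bar>" "\<bar>y\<bar>"] abs_ge_zero[of "x * y"]
    unfolding abs_mult power2_abs by linarith
  then show "AE \<omega> in M. norm (U \<omega> * V \<omega>) \<le> norm ((U \<omega>)\<^sup>2 + (V \<omega>)\<^sup>2)"
    by simp
qed simp

lemma (in prob_space) covariance_of_mean_zero:
  assumes "expectation U = 0" and "integrable M U" "integrable M (\<lambda>\<omega>. U \<omega> * V \<omega>)"
  shows "covariance M U V = expectation (\<lambda>\<omega>. U \<omega> * V \<omega>)"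
  using assms by (simp add: covariance_def right_diff_distrib)

lemma all_moments_finiteD:
  assumes [measurable]: "U \<in> borel_measurable M" and mom: "all_moments_finite M U"
  shows "integrable M U" "integrable M (\<lambda>\<omega>. (U \<omega>)\<^sup>2)" "integrable M (\<lambda>\<omega>. \<bar>U \<omega>\<bar> ^ 3)"
proof -
  have *: "integrable M (\<lambda>\<omega>. \<bar>U \<omega>\<bar> ^ k)" for k
    using mom by (simp add: all_moments_finite_def)
  show "integrable M U"
    using *[of 1] by (auto intro: integrable_abs_cancel)
  show "integrable M (\<lambda>\<omega>. (U \<omega>)\<^sup>2)"
    using *[of 2] by simp
  show "integrable M (\<lambda>\<omega>. \<bar>U \<omega>\<bar> ^ 3)"
    by (rule *)
qed

section \<open>From the radial characteristic function to normality and zero covariances\<close>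

theorem theorem3p2:
  fixes M :: "'a measure"
    and X :: "nat \<Rightarrow> 'a \<Rightarrow> real"
    and Y Z :: "'a \<Rightarrow> real"
    and m n :: nat
  assumes "prob_space M"
    and "1 \<le> m" and "m < n"
    and "\<And>i. i \<in> {1..n} \<Longrightarrow> X i \<in> borel_measurable M"
    and "Y \<in> borel_measurable M" and "Z \<in> borel_measurable M"
    and "\<And>i. i \<in> {1..n} \<Longrightarrow> all_moments_finite M (X i)"
    and "all_moments_finite M Y" and "all_moments_finite M Z"
    and "prob_space.indep_var M
           ((\<Pi>\<^sub>M i\<in>{1..m}. borel) \<Otimes>\<^sub>M borel) (\<lambda>\<omega>. (\<lambda>i\<in>{1..m}. X i \<omega>, Y \<omega>))
           ((\<Pi>\<^sub>M i\<in>{m+1..n}. borel) \<Otimes>\<^sub>M borel) (\<lambda>\<omega>. (\<lambda>i\<in>{m+1..n}. X i \<omega>, Z \<omega>))"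
    and "\<And>i. i \<in> {1..n} \<Longrightarrow> nondegenerate M (X i)"
    and "\<And>a a' :: nat \<Rightarrow> real. (\<Sum>i=1..n. (a i)\<^sup>2) = (\<Sum>i=1..n. (a' i)\<^sup>2) \<Longrightarrow>
           distr M borel (\<lambda>\<omega>. (\<Sum>i=1..n. a i * X i \<omega>) + Y \<omega> + Z \<omega>) =
           distr M borel (\<lambda>\<omega>. (\<Sum>i=1..n. a' i * X i \<omega>) + Y \<omega> + Z \<omega>)"
  shows "prob_space.indep_vars M (\<lambda>_. borel) X {1..n} \<and>
         (\<exists>\<sigma>>0. \<forall>i\<in>{1..n}. distributed M lborel (X i) (normal_density 0 \<sigma>)) \<and>
         (\<forall>i\<in>{1..n}. covariance M (X i) Y = 0 \<and> covariance M (X i) Z = 0)"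
proof -
  interpret prob_space M by fact
  note m = \<open>1 \<le> m\<close> \<open>m < n\<close>
  have X_meas: "X i \<in> borel_measurable M" if "i \<in> {1..n}" for i
    using assms(4) that .
  have [measurable]: "Y \<in> borel_measurable M" "Z \<in> borel_measurable M"
    by fact+
  note X_int = all_moments_finiteD[OF X_meas assms(7)]
  note Y_int = all_moments_finiteD[OF assms(5,8)]
  note Z_int = all_moments_finiteD[OF assms(6,9)]
  \<comment> \<open>Scalar independence is read off the two blocks through measurable functions;
    below these are coordinate projections, possibly scaled.\<close>
  have indep: "indep_var borel (\<lambda>\<omega>. f (\<lambda>i\<in>{1..m}. X i \<omega>, Y \<omega>)) borel (\<lambda>\<omega>. g (\<lambda>i\<in>{m+1..n}. X i \<omega>, Z \<omega>))"
    if "f \<in> borel_measurable ((\<Pi>\<^sub>M i\<in>{1..m}. borel) \<Otimes>\<^sub>M borel)"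
      "g \<in> borel_measurable ((\<Pi>\<^sub>M i\<in>{m+1..n}. borel) \<Otimes>\<^sub>M borel)" for f g :: "_ \<Rightarrow> real"
    using indep_var_compose[OF assms(10) that] by (simp add: comp_def)
  note distr_eq = assms(12)

  define S where "S a \<omega> = (\<Sum>i=1..n. a i * X i \<omega>)" for a :: "nat \<Rightarrow> real" and \<omega>
  have S_meas [measurable]: "S a \<in> borel_measurable M" for a
    unfolding S_def[abs_def] using X_meas by (intro borel_measurable_sum borel_measurable_times) auto
  define \<phi> where "\<phi> a = (CLINT \<omega>|M. iexp (S a \<omega>))" for a
  have radial: "\<phi> a = \<phi> a'" if eq: "(\<Sum>i=1..n. (a i)\<^sup>2) = (\<Sum>i=1..n. (a' i)\<^sup>2)" for a a'
  proof -
    have "(CLINT \<omega>|M. iexp (S a \<omega> + r * (Y \<omega> + Z \<omega>))) = (CLINT \<omega>|M. iexp (S a' \<omega> + r * (Y \<omega> + Z \<omega>)))"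
      if "r \<noteq> 0" for r
    proof -
      have *: "(CLINT \<omega>|M. iexp (S b \<omega> + r * (Y \<omega> + Z \<omega>))) =
        char (distr M borel (\<lambda>\<omega>. (\<Sum>i=1..n. (b i / r) * X i \<omega>) + Y \<omega> + Z \<omega>)) r" for b
      proof -
        have scale: "(\<Sum>i=1..n. (b i / r) * X i \<omega>) = S b \<omega> / r" for \<omega>
          by (simp add: S_def sum_divide_distrib)
        have "r * (S b \<omega> / r + Y \<omega> + Z \<omega>) = S b \<omega> + r * (Y \<omega> + Z \<omega>)" for \<omega>
          using that by (simp add: field_simps)
        then show ?thesis
          unfolding scale char_def
          by (subst integral_distr) (auto simp del: of_real_add of_real_mult)
      qed
      have "(\<Sum>i=1..n. (a i / r)\<^sup>2) = (\<Sum>i=1..n. (a' i / r)\<^sup>2)"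
        using eq by (simp add: power_divide flip: sum_divide_distrib)
      from distr_eq[OF this] show ?thesis
        unfolding * by simp
    qed
    \<comment> \<open>The null sequence \<open>1 / (k + 1)\<close> never vanishes, so the identity
      for nonzero \<open>r\<close> holds along all of it.\<close>
    then have "(\<lambda>k. CLINT \<omega>|M. iexp (S a \<omega> + inverse (real (Suc k)) * (Y \<omega> + Z \<omega>))) =
        (\<lambda>k. CLINT \<omega>|M. iexp (S a' \<omega> + inverse (real (Suc k)) * (Y \<omega> + Z \<omega>)))"
      by (intro ext) (simp only: of_nat_neq_0 inverse_nonzero_iff_nonzero not_False_eq_True)
    then have "(\<lambda>k. CLINT \<omega>|M. iexp (S a' \<omega> + inverse (real (Suc k)) * (Y \<omega> + Z \<omega>))) \<longlonglongrightarrow> \<phi> a"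
      unfolding \<phi>_def using tendsto_integral_iexp_add_small[of "S a" "\<lambda>\<omega>. Y \<omega> + Z \<omega>"] by simp
    then show ?thesis
      unfolding \<phi>_def
      using tendsto_integral_iexp_add_small[of "S a'" "\<lambda>\<omega>. Y \<omega> + Z \<omega>"] LIMSEQ_unique by auto
  qed

  \<comment> \<open>Placing the whole weight on one coordinate turns \<open>\<phi>\<close> into the
    characteristic function of that \<open>X i\<close>.\<close>
  define e :: "nat \<Rightarrow> real \<Rightarrow> nat \<Rightarrow> real" where "e i t = (\<lambda>j. if j = i then t else 0)" for i t
  have S_e: "S (e i t) \<omega> = t * X i \<omega>" and norm_e: "(\<Sum>j=1..n. (e i t j)\<^sup>2) = t\<^sup>2" if "i \<in> {1..n}" for i t \<omega>
    using that by (simp_all add: S_def e_def if_distrib[of "\<lambda>x. x * _"] if_distrib[of "\<lambda>x. x\<^sup>2"] cong: if_cong)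
  have \<phi>_e: "\<phi> (e i t) = char (distr M borel (X i)) t" if "i \<in> {1..n}" for i t
    using X_meas[OF that] by (simp add: \<phi>_def S_e[OF that] char_def integral_distr)
  \<comment> \<open>This radial profile is defined at negative arguments too, so the
    multiplicativity below covers signed coefficients.\<close>
  define \<psi> where "\<psi> = char (distr M borel (X 1))"
  have one: "1 \<in> {1..n}" and n: "n \<in> {1..n}"
    using m by auto
  have \<phi>_\<psi>: "\<phi> a = \<psi> (sqrt (\<Sum>i=1..n. (a i)\<^sup>2))" for a
    unfolding \<psi>_def \<phi>_e[OF one, symmetric] by (intro radial) (simp only: norm_e[OF one] real_sqrt_pow2 sum_nonneg zero_le_power2)
  interpret X1: real_distribution "distr M borel (X 1)"
    using X_meas[OF one] by simp
  have \<psi>_0: "\<psi> 0 = 1"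
    unfolding \<psi>_def by (rule X1.char_zero)
  have char_X: "char (distr M borel (X i)) t = \<psi> t" if "i \<in> {1..n}" for i t
    unfolding \<psi>_def \<phi>_e[OF one, symmetric] \<phi>_e[OF that, symmetric]
    by (intro radial) (simp only: norm_e[OF one] norm_e[OF that])
  have mult: "\<psi> (sqrt (s\<^sup>2 + t\<^sup>2)) = \<psi> s * \<psi> t" for s t
  proof -
    let ?a = "\<lambda>i. e 1 s i + e n t i"
    \<comment> \<open>The cross term vanishes because \<open>1\<close> and \<open>n\<close> are
      distinct indices.\<close>
    have sq: "(?a i)\<^sup>2 = (e 1 s i)\<^sup>2 + (e n t i)\<^sup>2" for i
      using m by (simp add: e_def)
    have "\<psi> (sqrt (s\<^sup>2 + t\<^sup>2)) = \<phi> ?a"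
      unfolding \<phi>_\<psi> sq sum.distrib norm_e[OF one] norm_e[OF n] ..
    also have "\<dots> = (CLINT \<omega>|M. iexp (s * X 1 \<omega> + t * X n \<omega>))"
      unfolding \<phi>_def S_e[OF one, symmetric] S_e[OF n, symmetric]
      by (simp add: S_def distrib_right sum.distrib)
    also have "\<dots> = char (distr M borel (\<lambda>\<omega>. s * X 1 \<omega> + t * X n \<omega>)) 1"
      using X_meas[OF one] X_meas[OF n] by (simp add: char_def integral_distr)
    \<comment> \<open>As \<open>1 \<le> m < n\<close>, index \<open>1\<close> lies in the first
      block and \<open>n\<close> in the second.\<close>
    also have "\<dots> = char (distr M borel (\<lambda>\<omega>. s * X 1 \<omega>)) 1 * char (distr M borel (\<lambda>\<omega>. t * X n \<omega>)) 1"
      using indep[of "\<lambda>p. s * fst p 1" "\<lambda>p. t * fst p n"] m by (intro char_distr_add) simp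
    also have "\<dots> = char (distr M borel (X 1)) s * char (distr M borel (X n)) t"
      using X_meas[OF one] X_meas[OF n] by (simp add: char_def integral_distr)
    finally show ?thesis
      by (simp only: char_X one n)
  qed
  note \<psi>_prod = multiplicative_on_norm_prod[OF \<psi>_0 mult]

  have "indep_vars (\<lambda>_. borel) X {1..n}"
  proof (rule indep_vars_of_char)
    fix u
    show "(CLINT \<omega>|M. iexp (\<Sum>i=1..n. u i * X i \<omega>)) = (\<Prod>i=1..n. char (distr M borel (X i)) (u i))"
      using \<phi>_\<psi>[of u] by (simp add: \<psi>_prod char_X \<phi>_def S_def)
  qed (use X_meas in auto)
  moreover have cross: "expectation (X i) = 0 \<and> expectation (\<lambda>\<omega>. X i \<omega> * (Y \<omega> + Z \<omega>)) = 0" if i: "i \<in> {1..n}" for i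
  proof -
    have [measurable]: "X i \<in> borel_measurable M"
      by (rule X_meas[OF i])
    have XV: "integrable M (\<lambda>\<omega>. X i \<omega> * (Y \<omega> + Z \<omega>))" "integrable M (\<lambda>\<omega>. (Y \<omega> + Z \<omega>)\<^sup>2)"
      using integrable_mult_of_squares[OF _ _ X_int(2)[OF i i] Y_int(2)]
        integrable_mult_of_squares[OF _ _ X_int(2)[OF i i] Z_int(2)]
        integrable_mult_of_squares[OF _ _ Y_int(2) Z_int(2)] Y_int Z_int
      by (simp_all add: distrib_left power2_sum mult.assoc)
    \<comment> \<open>The coefficients 1 and -1 at \<open>i\<close> have equal norm: the sign of
      \<open>X i\<close> flips while \<open>Y + Z\<close> stays.\<close>
    have "distr M borel (\<lambda>\<omega>. S (e i 1) \<omega> + Y \<omega> + Z \<omega>) = distr M borel (\<lambda>\<omega>. S (e i (- 1)) \<omega> + Y \<omega> + Z \<omega>)"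
      unfolding S_def by (rule distr_eq) (simp only: norm_e[OF i] power2_minus)
    then have "distr M borel (\<lambda>\<omega>. X i \<omega> + (Y \<omega> + Z \<omega>)) = distr M borel (\<lambda>\<omega>. - X i \<omega> + (Y \<omega> + Z \<omega>))"
      by (simp only: S_e[OF i] add.assoc mult_1 mult_minus1)
    from moments_of_symmetric_shift[OF _ _ X_int(1)[OF i i] _ X_int(2)[OF i i] XV(2,1) this] show ?thesis
      using Y_int(1) Z_int(1) by simp
  qed
  moreover have "\<exists>\<sigma>>0. \<forall>i\<in>{1..n}. distributed M lborel (X i) (normal_density 0 \<sigma>)"
  proof -
    define \<sigma> where "\<sigma> = sqrt (expectation (\<lambda>\<omega>. (X 1 \<omega>)\<^sup>2))"
    have sq: "\<sigma>\<^sup>2 = expectation (\<lambda>\<omega>. (X 1 \<omega>)\<^sup>2)"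
      by (simp add: \<sigma>_def)
    \<comment> \<open>Nondegeneracy enters here: a vanishing second moment would make
      \<open>X 1\<close> almost surely zero.\<close>
    have "expectation (\<lambda>\<omega>. (X 1 \<omega>)\<^sup>2) \<noteq> 0"
    proof
      assume "expectation (\<lambda>\<omega>. (X 1 \<omega>)\<^sup>2) = 0"
      then have "AE \<omega> in M. X 1 \<omega> = 0"
        using X_int(2)[OF one one] by (subst (asm) integral_nonneg_eq_0_iff_AE) auto
      then show False
        using assms(11)[OF one] by (auto simp: nondegenerate_def)
    qed
    then have "\<sigma> > 0"
      by (simp add: \<sigma>_def less_le)
    have gaussian: "\<psi> t = exp (- (\<sigma> * t)\<^sup>2 / 2)" for t
      unfolding \<psi>_def
    proof (rule X1.char_eq_gaussian)
      fix k :: nat assume "k > 0"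
      \<comment> \<open>A vector of \<open>k\<close> entries \<open>t / sqrt k\<close> has norm
        \<open>|t|\<close>, and \<open>mult\<close> with second argument 0 replaces \<open>t\<close>
        by \<open>|t|\<close>. Here \<open>k\<close> is unrelated to the number of
        variables.\<close>
      have "\<psi> t = \<psi> (sqrt (\<Sum>i<k. (t / sqrt (real k))\<^sup>2))"
        using mult[of t 0] \<open>k > 0\<close> by (simp add: \<psi>_0 power_divide)
      also have "\<dots> = \<psi> (t / sqrt (real k)) ^ k"
        by (subst \<psi>_prod) simp_all
      finally show "char (distr M borel (X 1)) t = char (distr M borel (X 1)) (t / sqrt (real k)) ^ k"
        unfolding \<psi>_def .
    qed (use X_int[OF one one] X_meas[OF one] cross[OF one] in \<open>simp_all add: integrable_distr_eq integral_distr sq\<close>)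
    show ?thesis
      using \<open>\<sigma> > 0\<close> gaussian X_meas char_X by (intro exI[of _ \<sigma>]) (auto intro!: distributed_normal_of_char)
  qed
  moreover have "covariance M (X i) Y = 0 \<and> covariance M (X i) Z = 0" if i: "i \<in> {1..n}" for i
  proof -
    have XY: "integrable M (\<lambda>\<omega>. X i \<omega> * Y \<omega>)" and XZ: "integrable M (\<lambda>\<omega>. X i \<omega> * Z \<omega>)"
      by (intro integrable_mult_of_squares X_meas[OF i] X_int(2)[OF i i] Y_int Z_int; measurable)+
    have sum: "expectation (\<lambda>\<omega>. X i \<omega> * Y \<omega>) + expectation (\<lambda>\<omega>. X i \<omega> * Z \<omega>) = 0"
      using cross[OF i] XY XZ by (simp add: distrib_left)
    \<comment> \<open>The mean of the product of \<open>X i\<close> with the variable of the other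
      block is a product of means, and \<open>X i\<close> is centred; \<open>sum\<close> then
      settles the remaining one.\<close>
    have "expectation (\<lambda>\<omega>. X i \<omega> * Y \<omega>) = 0 \<or> expectation (\<lambda>\<omega>. X i \<omega> * Z \<omega>) = 0"
    proof (cases "i \<le> m")
      case True
      then have "indep_var borel (X i) borel Z"
        using indep[of "\<lambda>p. fst p i" snd] i by simp
      then show ?thesis
        using indep_var_lebesgue_integral[OF _ X_int(1)[OF i i] Z_int(1)] cross[OF i] by simp
    next
      case False
      then have "indep_var borel Y borel (X i)"
        using indep[of snd "\<lambda>p. fst p i"] i by simp
      then show ?thesis
        using indep_var_lebesgue_integral[OF _ Y_int(1) X_int(1)[OF i i]] cross[OF i]
        by (simp add: mult.commute)
    qed
    with sum show ?thesis
      using cross[OF i] X_int(1)[OF i i] XY XZ by (auto simp: covariance_of_mean_zero)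
  qed
  ultimately show ?thesis
    by blast
qed

end
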